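(* Let $Y$ be a real random variable whose moment generating function $E[e^{tY}]$ exists for $|t|<r$, for some $r>0$. Then for any integers $n,k$ with $n\ge k\ge 0$ and every real $x$, $$\sum_{j=0}^{n-k}\binom{n}{k}k^{j}x^{j}L_{Y}(n-k,j)= B_{n,k}\Big(B_{0}^{(L,Y)}(x),\,2B_{1}^{(L,Y)}(x),\,\dots,\,(n-k+1)B_{n-k}^{(L,Y)}(x)\Big),$$ with the convention $0^0=1$.
   Context: Partial Bell polynomials $B_{n,k}$ ($n\ge k\ge 0$) are defined by the formal power series identity $$\frac{1}{k!}\left(\sum_{j=1}^{\infty}x_{j}\frac{t^{j}}{j!}\right)^{k}=\sum_{n=k}^{\infty}B_{n,k}(x_{1},x_{2},\dots,x_{n-k+1})\frac{t^{n}}{n!}.$$ On the right-hand side of the claim the $i$-th argument of $B_{n,k}$ is $iB_{i-1}^{(L,Y)}(x)$ (for $k=0$, $B_{n,0}$ is the constant $1$ if $n=0$ and $0$ if $n\geq 1$). The probabilistic Lah numbers $L_Y(n,k)$ ($n\ge k\ge 0$) associated with $Y$ are defined by the power series expansion about $t=0$ $$\frac{1}{k!}\left(E\left[\left(\frac{1}{1-t}\right)^{Y}\right]-1\right)^{k}=\sum_{n=k}^{\infty}L_{Y}(n,k)\frac{t^{n}}{n!},\quad k\ge 0.$$ The probabilistic Lah-Bell polynomials associated with $Y$ are $B_{n}^{(L,Y)}(x)=\sum_{k=0}^{n}L_{Y}(n,k)x^{k}$, $n\ge 0$. *)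

theory Defs
  imports "HOL-Probability.Probability"
begin

text \<open>
  The arguments \<open>x\<^sub>1, x\<^sub>2, \<dots>\<close> of the partial Bell polynomial are passed as a sequence \<open>x\<close>
  (the value \<open>x 0\<close> is ignored); by \<open>partial_Bell_cong\<close> below only \<open>x\<^sub>1, \<dots>, x\<^sub>n\<^sub>-\<^sub>k\<^sub>+\<^sub>1\<close> matter.
\<close>

definition partial_Bell :: "nat \<Rightarrow> nat \<Rightarrow> (nat \<Rightarrow> real) \<Rightarrow> real" where
  "partial_Bell n k x =
     fact n * fps_nth (fps_const (1 / fact k) *
                       Abs_fps (\<lambda>j. if j = 0 then 0 else x j / fact j) ^ k) n"

text \<open>
  The power series in \<open>t\<close> about \<open>0\<close> representing \<open>(E[(1/(1-t))\<^sup>Y] - 1)\<^sup>k / k!\<close>; it is unique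
  whenever it exists, see \<open>prob_Lah_eqI\<close>.
\<close>

definition prob_Lah :: "'a measure \<Rightarrow> ('a \<Rightarrow> real) \<Rightarrow> nat \<Rightarrow> nat \<Rightarrow> real" where
  "prob_Lah M Y n k =
     fact n * fps_nth (THE F. (\<lambda>t::real. 1 / fact k *
       ((LINT \<omega>|M. (1 / (1 - t)) powr Y \<omega>) - 1) ^ k) has_fps_expansion F) n"

definition prob_Lah_Bell :: "'a measure \<Rightarrow> ('a \<Rightarrow> real) \<Rightarrow> nat \<Rightarrow> real \<Rightarrow> real" where
  "prob_Lah_Bell M Y n x = (\<Sum>k=0..n. prob_Lah M Y n k * x ^ k)"

lemma partial_Bell_gf:
  "fps_const (1 / fact k) * Abs_fps (\<lambda>j. if j = 0 then 0 else x j / fact j) ^ k =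
     Abs_fps (\<lambda>n. partial_Bell n k x / fact n)"
  by (rule fps_ext) (simp add: partial_Bell_def)

lemma partial_Bell_eq_0:
  assumes "n < k"
  shows "partial_Bell n k x = 0"
proof -
  have "fps_nth (Abs_fps (\<lambda>j. if j = 0 then 0 else x j / fact j) ^ k) n = 0"
    by (rule startsby_zero_power_prefix[rule_format]) (use assms in auto)
  then show ?thesis by (simp add: partial_Bell_def)
qed

lemma partial_Bell_0: "partial_Bell n 0 x = (if n = 0 then 1 else 0)"
  by (simp add: partial_Bell_def)

lemma partial_Bell_cong:
  assumes "\<And>i. i \<in> {1..n - k + 1} \<Longrightarrow> x i = y i"
  shows "partial_Bell n k x = partial_Bell n k y"
proof -
  define S where "S x = Abs_fps (\<lambda>j. x (Suc j) / fact (Suc j) :: real)" for x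
  have *: "Abs_fps (\<lambda>j. if j = 0 then 0 else x j / fact j) = fps_X * S x" for x
  proof (rule fps_ext)
    fix n
    show "fps_nth (Abs_fps (\<lambda>j. if j = 0 then 0 else x j / fact j)) n = fps_nth (fps_X * S x) n"
      by (cases n) (simp_all add: S_def)
  qed
  have pw: "fps_nth (S x ^ m) i = fps_nth (S y ^ m) i" if "i \<le> n - k" for m i
    using that
  proof (induction m arbitrary: i)
    case (Suc m)
    have "fps_nth (S x) j = fps_nth (S y) j" if "j \<le> i" for j
      using that Suc.prems assms by (simp add: S_def)
    with Suc show ?case
      by (auto simp: fps_mult_nth intro!: sum.cong)
  qed simp
  show ?thesis
    unfolding partial_Bell_def * by (simp add: power_mult_distrib fps_X_power_mult_nth pw)
qed

lemma has_fps_expansion_unique_real: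
  fixes f :: "real \<Rightarrow> real"
  assumes "f has_fps_expansion F" "f has_fps_expansion G"
  shows "F = G"
proof (rule ccontr)
  assume "F \<noteq> G"
  define H where "H = F - G"
  define m where "m = subdegree H"
  define c where "c = fps_nth H m"
  have "c \<noteq> 0" using \<open>F \<noteq> G\<close> nth_subdegree_nonzero[of H]
    unfolding c_def m_def by (simp add: H_def del: fps_sub_nth)
  have "(\<lambda>x. f x - f x) has_fps_expansion H"
    unfolding H_def by (intro has_fps_expansion_diff assms)
  then have "(\<lambda>x. if x = 0 then c else (f x - f x) / x ^ m) has_fps_expansion fps_shift m H"
    by (rule has_fps_expansion_shift) (simp_all add: c_def m_def)
  then have "isCont (\<lambda>x. if x = 0 then c else (f x - f x) / x ^ m) 0"
    by (rule has_fps_expansion_imp_continuous)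
  then have "((\<lambda>x::real. if x = 0 then c else 0) \<longlongrightarrow> c) (at 0)"
    by (simp add: isCont_def if_distrib cong: if_cong)
  moreover have "((\<lambda>x::real. if x = 0 then c else 0) \<longlongrightarrow> 0) (at 0)"
    by (rule tendsto_eventually) (simp add: eventually_at_filter)
  ultimately have "c = 0" by (rule tendsto_unique[rotated]) simp
  with \<open>c \<noteq> 0\<close> show False ..
qed

lemma prob_Lah_eqI:
  assumes "(\<lambda>t::real. 1 / fact k *
       ((LINT \<omega>|M. (1 / (1 - t)) powr Y \<omega>) - 1) ^ k) has_fps_expansion F"
  shows "prob_Lah M Y n k = fact n * fps_nth F n"
proof -
  have "(THE F. (\<lambda>t::real. 1 / fact k *
       ((LINT \<omega>|M. (1 / (1 - t)) powr Y \<omega>) - 1) ^ k) has_fps_expansion F) = F"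
  proof (rule the_equality)
    fix G
    assume "(\<lambda>t::real. 1 / fact k *
       ((LINT \<omega>|M. (1 / (1 - t)) powr Y \<omega>) - 1) ^ k) has_fps_expansion G"
    with assms show "G = F"
      by (rule has_fps_expansion_unique_real[rotated])
  qed fact
  then show ?thesis by (simp add: prob_Lah_def)
qed

end

theory Submission
  imports Defs "HOL-Complex_Analysis.Laurent_Convergence"
begin

text \<open>
  If \<open>F\<close> is the power series of \<open>E[(1/(1-t))\<^sup>Y]\<close> at \<open>0\<close>, the exponential generating function of the
  Lah-Bell polynomials is \<open>exp (x (F - 1))\<close>, so raising it to the power \<open>k\<close> replaces \<open>x\<close> by \<open>k x\<close>.
  The sequence \<open>i B\<^sub>i\<^sub>-\<^sub>1(x)\<close> has generating function \<open>t exp (x (F - 1))\<close>; the claim compares the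
  coefficients of its \<open>k\<close>-th power \<open>t\<^sup>k exp (k x (F - 1))\<close>. That \<open>F\<close> exists follows by integrating
  the binomial series of \<open>(1/(1-t))\<^sup>Y\<close> termwise: for \<open>\<bar>t\<bar> < 1 - e\<^sup>-\<^sup>s\<close> its absolute partial sums
  are dominated by \<open>exp (s \<bar>Y\<bar>)\<close>.
\<close>

lemma pochhammer_series_sums:
  fixes a t :: real
  assumes "\<bar>t\<bar> < 1"
  shows "(\<lambda>n. pochhammer a n / fact n * t ^ n) sums (1 / (1 - t)) powr a"
proof -
  have "(\<lambda>n. ((- a) gchoose n) * (- t) ^ n) sums (1 + - t) powr (- a)"
    by (rule gen_binomial_real) (use assms in simp)
  moreover have "((- a) gchoose n) * (- t) ^ n = pochhammer a n / fact n * t ^ n" for n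
    by (simp add: gbinomial_pochhammer power_minus[of t] field_simps)
  moreover have "(1 + - t) powr (- a) = (1 / (1 - t)) powr a"
    using assms by (simp add: powr_minus powr_divide inverse_eq_divide)
  ultimately show ?thesis by simp
qed

lemma norm_pochhammer_le: "norm (pochhammer a n) \<le> pochhammer (norm a) n"
  for a :: "'a::real_normed_field"
  unfolding pochhammer_prod prod_norm[symmetric]
  by (intro prod_mono) (auto intro: order_trans[OF norm_triangle_ineq])

lemma pochhammer_partial_sum_le:
  fixes a u :: real
  assumes "0 \<le> u" "u < 1"
  shows "(\<Sum>n<N. \<bar>pochhammer a n / fact n\<bar> * u ^ n) \<le> (1 / (1 - u)) powr \<bar>a\<bar>"
proof -
  have abs_pochhammer_le: "\<bar>pochhammer a n\<bar> \<le> pochhammer \<bar>a\<bar> n" for n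
    using norm_pochhammer_le[of a n] by simp
  have nonneg: "0 \<le> pochhammer \<bar>a\<bar> n / fact n * u ^ n" for n
    using \<open>0 \<le> u\<close> order_trans[OF abs_ge_zero abs_pochhammer_le[of n]] by simp
  have series: "(\<lambda>n. pochhammer \<bar>a\<bar> n / fact n * u ^ n) sums (1 / (1 - u)) powr \<bar>a\<bar>"
    using assms by (intro pochhammer_series_sums) simp
  have "(\<Sum>n<N. \<bar>pochhammer a n / fact n\<bar> * u ^ n) \<le> (\<Sum>n<N. pochhammer \<bar>a\<bar> n / fact n * u ^ n)"
    using \<open>0 \<le> u\<close> by (intro sum_mono mult_right_mono) (simp_all add: divide_right_mono abs_pochhammer_le)
  also have "\<dots> \<le> (\<Sum>n. pochhammer \<bar>a\<bar> n / fact n * u ^ n)"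
    using nonneg by (intro sum_le_suminf sums_summable[OF series]) auto
  also have "\<dots> = (1 / (1 - u)) powr \<bar>a\<bar>"
    using sums_unique[OF series] by simp
  finally show ?thesis .
qed

lemma sums_integral_dominated:
  fixes f :: "nat \<Rightarrow> 'a \<Rightarrow> 'b::{banach, second_countable_topology}"
  assumes [measurable]: "\<And>n. f n \<in> borel_measurable M"
    and W: "integrable M W"
    and dominated: "\<And>N \<omega>. \<omega> \<in> space M \<Longrightarrow> (\<Sum>n<N. norm (f n \<omega>)) \<le> W \<omega>"
    and sums: "\<And>\<omega>. \<omega> \<in> space M \<Longrightarrow> (\<lambda>n. f n \<omega>) sums g \<omega>"
  shows "(\<lambda>n. LINT \<omega>|M. f n \<omega>) sums (LINT \<omega>|M. g \<omega>)"
proof -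
  have integrable: "integrable M (f n)" for n
  proof (rule Bochner_Integration.integrable_bound[OF W])
    have "norm (f n \<omega>) \<le> norm (W \<omega>)" if "\<omega> \<in> space M" for \<omega>
    proof -
      have "norm (f n \<omega>) \<le> (\<Sum>m<Suc n. norm (f m \<omega>))"
        by (rule member_le_sum) auto
      also have "\<dots> \<le> norm (W \<omega>)"
        using dominated[OF that, of "Suc n"] by simp
      finally show ?thesis .
    qed
    then show "AE \<omega> in M. norm (f n \<omega>) \<le> norm (W \<omega>)"
      by (rule AE_I2)
  qed simp
  have "summable (\<lambda>n. norm (f n \<omega>))" if "\<omega> \<in> space M" for \<omega>
    by (rule summableI_nonneg_bounded[where x = "W \<omega>"]) (simp_all add: dominated[OF that])
  then have "AE \<omega> in M. summable (\<lambda>n. norm (f n \<omega>))"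
    by (rule AE_I2)
  moreover have "summable (\<lambda>n. LINT \<omega>|M. norm (f n \<omega>))"
  proof (rule summableI_nonneg_bounded)
    fix N
    have "(\<Sum>n<N. LINT \<omega>|M. norm (f n \<omega>)) = (LINT \<omega>|M. (\<Sum>n<N. norm (f n \<omega>)))"
      using integrable by (simp add: Bochner_Integration.integral_sum)
    also have "\<dots> \<le> (LINT \<omega>|M. W \<omega>)"
      using integrable W dominated by (intro integral_mono) auto
    finally show "(\<Sum>n<N. LINT \<omega>|M. norm (f n \<omega>)) \<le> (LINT \<omega>|M. W \<omega>)" .
  qed simp
  ultimately have "(\<lambda>n. LINT \<omega>|M. f n \<omega>) sums (LINT \<omega>|M. (\<Sum>n. f n \<omega>))"
    by (rule sums_integral[OF integrable])
  also have "(LINT \<omega>|M. (\<Sum>n. f n \<omega>)) = (LINT \<omega>|M. g \<omega>)"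
    using sums by (intro Bochner_Integration.integral_cong) (auto simp: sums_unique[symmetric])
  finally show ?thesis .
qed

lemma has_fps_expansion_integral:
  fixes c :: "nat \<Rightarrow> 'a \<Rightarrow> 'b::{banach, real_normed_field, second_countable_topology}"
  assumes [measurable]: "\<And>n. c n \<in> borel_measurable M"
    and W: "integrable M W"
    and "u > 0"
    and dominated: "\<And>N \<omega>. \<omega> \<in> space M \<Longrightarrow> (\<Sum>n<N. norm (c n \<omega>) * u ^ n) \<le> W \<omega>"
    and sums: "\<And>t \<omega>. norm t < u \<Longrightarrow> \<omega> \<in> space M \<Longrightarrow> (\<lambda>n. c n \<omega> * t ^ n) sums f t \<omega>"
  shows "(\<lambda>t. LINT \<omega>|M. f t \<omega>) has_fps_expansion Abs_fps (\<lambda>n. LINT \<omega>|M. c n \<omega>)"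
proof (rule has_fps_expansionI)
  have "(\<lambda>n. (LINT \<omega>|M. c n \<omega>) * t ^ n) sums (LINT \<omega>|M. f t \<omega>)" if t: "norm t < u" for t
  proof -
    have "(\<Sum>n<N. norm (c n \<omega> * t ^ n)) \<le> W \<omega>" if "\<omega> \<in> space M" for N \<omega>
    proof -
      have "(\<Sum>n<N. norm (c n \<omega> * t ^ n)) \<le> (\<Sum>n<N. norm (c n \<omega>) * u ^ n)"
        unfolding norm_mult norm_power using t
        by (intro sum_mono mult_left_mono power_mono) auto
      with dominated[OF that, of N] show ?thesis by simp
    qed
    then have "(\<lambda>n. LINT \<omega>|M. c n \<omega> * t ^ n) sums (LINT \<omega>|M. f t \<omega>)"
      using sums[OF t] by (intro sums_integral_dominated[OF _ W]) auto
    then show ?thesis by simp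
  qed
  moreover have "eventually (\<lambda>t::'b. norm t < u) (nhds 0)"
    using eventually_nhds_in_open[of "ball 0 u" "0::'b"] \<open>u > 0\<close> by simp
  ultimately show "eventually (\<lambda>t. (\<lambda>n. fps_nth (Abs_fps (\<lambda>n. LINT \<omega>|M. c n \<omega>)) n * t ^ n)
      sums (LINT \<omega>|M. f t \<omega>)) (nhds 0)"
    by (auto elim: eventually_mono)
qed

lemma integrable_exp_abs:
  fixes X :: "'a \<Rightarrow> real"
  assumes [measurable]: "X \<in> borel_measurable M"
    and "integrable M (\<lambda>\<omega>. exp (X \<omega>))" "integrable M (\<lambda>\<omega>. exp (- X \<omega>))"
  shows "integrable M (\<lambda>\<omega>. exp \<bar>X \<omega>\<bar>)"
proof (rule Bochner_Integration.integrable_bound)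
  show "integrable M (\<lambda>\<omega>. exp (X \<omega>) + exp (- X \<omega>))"
    using assms by simp
  have "exp \<bar>X \<omega>\<bar> \<le> exp (X \<omega>) + exp (- X \<omega>)" for \<omega>
    by (simp add: abs_if)
  then show "AE \<omega> in M. norm (exp \<bar>X \<omega>\<bar>) \<le> norm (exp (X \<omega>) + exp (- X \<omega>))"
    by (auto intro: order_trans[OF _ abs_ge_self])
qed measurable

lemma integral_powr_has_fps_expansion:
  fixes Y :: "'a \<Rightarrow> real"
  assumes [measurable]: "Y \<in> borel_measurable M"
    and "s > 0"
    and integrable_exp: "integrable M (\<lambda>\<omega>. exp (s * Y \<omega>))" "integrable M (\<lambda>\<omega>. exp (- s * Y \<omega>))"
  shows "(\<lambda>t. LINT \<omega>|M. (1 / (1 - t)) powr Y \<omega>) has_fps_expansion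
           Abs_fps (\<lambda>n. LINT \<omega>|M. pochhammer (Y \<omega>) n / fact n)"
proof (rule has_fps_expansion_integral)
  define u where "u = 1 - exp (- s)"
  show "u > 0"
    using \<open>s > 0\<close> by (simp add: u_def)
  have "u < 1"
    by (simp add: u_def)
  show "(\<lambda>\<omega>. pochhammer (Y \<omega>) n / fact n) \<in> borel_measurable M" for n
    unfolding pochhammer_prod by measurable
  show "integrable M (\<lambda>\<omega>. exp \<bar>s * Y \<omega>\<bar>)"
    using integrable_exp by (intro integrable_exp_abs) auto
  have "(1 / (1 - u)) powr \<bar>Y \<omega>\<bar> = exp \<bar>s * Y \<omega>\<bar>" for \<omega>
    using \<open>s > 0\<close> by (simp add: u_def powr_def ln_div abs_mult mult.commute)
  then show "(\<Sum>n<N. norm (pochhammer (Y \<omega>) n / fact n) * u ^ n) \<le> exp \<bar>s * Y \<omega>\<bar>" for N \<omega>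
    using pochhammer_partial_sum_le[of u "Y \<omega>" N] \<open>u > 0\<close> \<open>u < 1\<close> by simp
  show "(\<lambda>n. pochhammer (Y \<omega>) n / fact n * t ^ n) sums (1 / (1 - t)) powr Y \<omega>"
    if "norm t < u" for t \<omega>
    using that \<open>u < 1\<close> by (intro pochhammer_series_sums) simp
qed

definition egf :: "(nat \<Rightarrow> 'a::field_char_0) \<Rightarrow> 'a fps" where
  "egf a = Abs_fps (\<lambda>n. a n / fact n)"

lemma fps_nth_egf [simp]: "fps_nth (egf a) n = a n / fact n"
  by (simp add: egf_def)

lemma partial_Bell_of_nat_mult_pred:
  assumes "k \<le> n"
  shows "partial_Bell n k (\<lambda>i. real i * a (i - 1)) =
    real (n choose k) * (fact (n - k) * fps_nth (egf a ^ k) (n - k))"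
proof -
  have "Abs_fps (\<lambda>j. if j = 0 then 0 else real j * a (j - 1) / fact j) = fps_X * egf a"
    by (rule fps_ext) (simp add: fact_reduce)
  then have "partial_Bell n k (\<lambda>i. real i * a (i - 1)) =
      fact n / fact k * fps_nth (egf a ^ k) (n - k)"
    using assms by (simp add: partial_Bell_def power_mult_distrib fps_X_power_mult_nth del: One_nat_def)
  then show ?thesis
    using assms by (simp add: binomial_fact)
qed

lemma prob_Lah_eq_fps_nth:
  assumes "(\<lambda>t. LINT \<omega>|M. (1 / (1 - t)) powr Y \<omega>) has_fps_expansion F"
  shows "prob_Lah M Y n k = fact n / fact k * fps_nth ((F - 1) ^ k) n"
proof -
  have "(\<lambda>t. 1 / fact k * ((LINT \<omega>|M. (1 / (1 - t)) powr Y \<omega>) - 1) ^ k)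
      has_fps_expansion fps_const (1 / fact k) * (F - 1) ^ k"
    by (intro fps_expansion_intros assms)
  then show ?thesis
    by (simp add: prob_Lah_eqI)
qed

lemma egf_prob_Lah_Bell:
  assumes "(\<lambda>t. LINT \<omega>|M. (1 / (1 - t)) powr Y \<omega>) has_fps_expansion F"
  shows "egf (\<lambda>n. prob_Lah_Bell M Y n x) = fps_exp x oo (F - 1)"
  by (rule fps_ext)
    (simp add: prob_Lah_Bell_def prob_Lah_eq_fps_nth[OF assms] fps_compose_nth
      sum_divide_distrib mult_ac)

lemma (in prob_space) egf_prob_Lah_Bell_power:
  assumes F: "(\<lambda>t. expectation (\<lambda>\<omega>. (1 / (1 - t)) powr Y \<omega>)) has_fps_expansion F"
  shows "egf (\<lambda>n. prob_Lah_Bell M Y n x) ^ k = egf (\<lambda>n. prob_Lah_Bell M Y n (real k * x))"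
proof -
  have "fps_nth (F - 1) 0 = 0"
    using has_fps_expansion_imp_0_eq_fps_nth_0[OF F] by (simp add: prob_space)
  then show ?thesis
    by (simp add: egf_prob_Lah_Bell[OF F] fps_compose_power fps_exp_power_mult)
qed

theorem theorem2p9:
  fixes M :: "'a measure" and Y :: "'a \<Rightarrow> real" and r x :: real and n k :: nat
  assumes "prob_space M"
    and "Y \<in> borel_measurable M"
    and "r > 0"
    and "\<And>t::real. \<bar>t\<bar> < r \<Longrightarrow> integrable M (\<lambda>\<omega>. exp (t * Y \<omega>))"
    and "k \<le> n"
  shows "(\<Sum>j=0..n - k. real (n choose k) * real k ^ j * x ^ j * prob_Lah M Y (n - k) j) =
    partial_Bell n k (\<lambda>i. real i * prob_Lah_Bell M Y (i - 1) x)"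
proof -
  interpret prob_space M by fact
  have "integrable M (\<lambda>\<omega>. exp (r / 2 * Y \<omega>))" "integrable M (\<lambda>\<omega>. exp (- (r / 2) * Y \<omega>))"
    using \<open>r > 0\<close> by (intro assms(4); simp)+
  with assms(2,3) obtain F
    where F: "(\<lambda>t. expectation (\<lambda>\<omega>. (1 / (1 - t)) powr Y \<omega>)) has_fps_expansion F"
    using integral_powr_has_fps_expansion[of Y M "r / 2"] by (metis half_gt_zero)
  have "(\<Sum>j=0..n - k. real (n choose k) * real k ^ j * x ^ j * prob_Lah M Y (n - k) j) =
      real (n choose k) * prob_Lah_Bell M Y (n - k) (real k * x)"
    by (simp add: prob_Lah_Bell_def sum_distrib_left power_mult_distrib mult_ac)
  also have "\<dots> = real (n choose k) *
      (fact (n - k) * fps_nth (egf (\<lambda>m. prob_Lah_Bell M Y m x) ^ k) (n - k))"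
    by (simp add: egf_prob_Lah_Bell_power[OF F])
  also have "\<dots> = partial_Bell n k (\<lambda>i. real i * prob_Lah_Bell M Y (i - 1) x)"
    using \<open>k \<le> n\<close> by (rule partial_Bell_of_nat_mult_pred[symmetric])
  finally show ?thesis .
qed

end
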